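(* The Riemann Hypothesis is true if and only if for every compact disc $K$ contained in $\{\tfrac12<\Re(s)<1\}$ there exist: functions $f(N,\cdot)$ ($N\in\mathbb{N}$), each analytic on a neighbourhood of $K$, with $\sup_{s\in K}|f(N,s)|\to0$ as $N\to\infty$; an integer $d\ge1$ and complex numbers $\alpha_1,\dots,\alpha_d$; and positive integers $L_1,\dots,L_d,N_0$, such that for infinitely many $N>N_0$ the function $$f(N,s)+\alpha_1H_N(s)+\alpha_2H_{N+L_1}(s)+\cdots+\alpha_dH_{N+L_{d-1}}(s)+\Big(1-\sum_{i=1}^d\alpha_i\Big)H_{N+L_d}(s)$$ is non-vanishing for all $s\in K$.
   Context: $\zeta$ is the Riemann zeta function; the Riemann Hypothesis states that every zero of $\zeta$ in the critical strip $0<\Re(s)<1$ has real part $\tfrac12$. For $N\in\mathbb{N}$ and $s\ne1$, $H_N(s)=\sum_{n=1}^{N}n^{-s}+\frac{N^{1-s}}{s-1}$. *)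

theory Defs
  imports "HOL-Complex_Analysis.Complex_Analysis"
begin

(* f is the analytic continuation of the Dirichlet series to the half-plane Re s > a,
   with the pole at 1 removed. *)
definition continues_zeta :: "real \<Rightarrow> (complex \<Rightarrow> complex) \<Rightarrow> bool" where
  "continues_zeta a f \<longleftrightarrow>
     f holomorphic_on ({s. Re s > a} - {1}) \<and>
     (\<forall>s. Re s > 1 \<longrightarrow> (\<lambda>n. of_nat (Suc n) powr (-s)) sums f s)"

(* The Riemann zeta function: the value at s of the analytic continuation of the Dirichlet
   series to any punctured half-plane containing s. These domains are nested and connected,
   so the value is independent of the choice (lemma zeta_eqI below). The value at the
   pole s = 1 is unspecified. *)
definition zeta :: "complex \<Rightarrow> complex" where
  "zeta s = (THE z. \<exists>a f. a < Re s \<and> continues_zeta a f \<and> f s = z)"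

lemma continues_zeta_unique:
  assumes f: "continues_zeta a f" and g: "continues_zeta b g"
    and s: "a < Re s" "b < Re s" "s \<noteq> 1"
  shows "f s = g s"
proof -
  define S where "S = {s. Re s > max a b} - {1}"
  define m where "m = max 1 (max a b)"
  have S_open: "open S"
    unfolding S_def by (intro open_delete open_halfspace_Re_gt)
  have S_conn: "connected S"
    unfolding S_def
    by (intro connected_open_delete open_halfspace_Re_gt convex_connected convex_halfspace_Re_gt)
       auto
  have hol: "f holomorphic_on S" "g holomorphic_on S"
    using f g unfolding continues_zeta_def S_def by (auto elim!: holomorphic_on_subset)
  show ?thesis
  proof (rule analytic_continuation_open[where s = "{s. Re s > m}" and s' = S and f = f and g = g])
    have "of_real (m + 1) \<in> {s. Re s > m}" by simp
    then show "{s. Re s > m} \<noteq> {}" by blast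
    show "f z = g z" if "z \<in> {s. Re s > m}" for z
    proof -
      have "Re z > 1" using that by (simp add: m_def)
      then show ?thesis
        using f g unfolding continues_zeta_def by (blast intro: sums_unique2)
    qed
    show "open {s. Re s > m}" by (rule open_halfspace_Re_gt)
    show "{s. Re s > m} \<subseteq> S" "s \<in> S" using s by (auto simp: S_def m_def)
  qed (use S_open S_conn hol in auto)
qed

lemma zeta_eqI:
  assumes "continues_zeta a f" "a < Re s" "s \<noteq> 1"
  shows "zeta s = f s"
  unfolding zeta_def using assms continues_zeta_unique by (intro the_equality) blast+

definition riemann_hypothesis :: bool where
  "riemann_hypothesis \<longleftrightarrow>
     (\<forall>s. 0 < Re s \<and> Re s < 1 \<and> zeta s = 0 \<longrightarrow> Re s = 1 / 2)"

definition H :: "nat \<Rightarrow> complex \<Rightarrow> complex" where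
  "H N s = (\<Sum>n=1..N. of_nat n powr (-s)) + of_nat N powr (1 - s) / (s - 1)"

end

(*
  The functions H N converge to zeta locally uniformly on Re s > 0, s ~= 1, and the coefficients
  of the combination sum to 1, so the combination tends to zeta as well. If zeta does not vanish
  on K, then H N itself is eventually zero-free on K; conversely, by Hurwitz's theorem
  infinitely many zero-free terms make zeta zero-free on the interior of K.

  This controls zeros with 1/2 < Re s < 1; zeros with Re s < 1/2 are reflected by a functional
  equation. By Euler-Maclaurin, zeta s = -s * (integral over u > 0 of frac u * u powr (-s-1)) for
  0 < Re s < 1. The partial fraction expansion of 1/(exp x - 1) amounts to the identity
     integral of frac u * exp(-x u)  =  integral of 16 pi^2 * frac u * u / (x^2 + 4 pi^2 u^2)^2
  for every x > 0. Multiplying by x powr s and integrating over x, Fubini turns the left side into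
  -(zeta s / s) * Gamma (s+1) and the right side into a multiple of zeta (1-s). Everything
  converges absolutely for 0 < Re s < 1, so no further continuation is needed.
*)
theory Submission
  imports Defs "HOL-Real_Asymp.Real_Asymp"
begin

section \<open>Euler-Maclaurin summation and improper integrals over the positive reals\<close>

text \<open>
  First-order Euler--Maclaurin summation. Continuity of \<open>u *\<^sub>R \<phi> u\<close> rather than of \<open>\<phi>\<close> at
  \<open>0\<close> admits \<open>\<phi> u = u powr (-s)\<close>.
\<close>
lemma has_integral_frac:
  fixes \<phi> \<phi>' \<Phi> :: "real \<Rightarrow> 'a::banach"
  assumes cont: "continuous_on {0..} \<Phi>" "continuous_on {0..} (\<lambda>u. u *\<^sub>R \<phi> u)"
    and \<phi>: "\<And>u. u > 0 \<Longrightarrow> (\<phi> has_vector_derivative \<phi>' u) (at u)"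
    and \<Phi>: "\<And>u. u > 0 \<Longrightarrow> (\<Phi> has_vector_derivative \<phi> u) (at u)"
  shows "((\<lambda>u. frac u *\<^sub>R \<phi>' u) has_integral (\<Sum>n=1..N. \<phi> (real n)) - \<Phi> (real N) + \<Phi> 0) {0..real N}"
proof (induction N)
  case 0
  show ?case by (simp add: has_integral_refl(2)[of _ "0::real", simplified])
next
  case (Suc N)
  \<comment> \<open>An antiderivative of \<open>(u - real N) *\<^sub>R \<phi>' u\<close>: the
    derivative of \<open>\<Phi>\<close> cancels the term \<open>\<phi> u\<close> of the product
    rule. For \<open>N = 0\<close> only \<open>u *\<^sub>R \<phi> u\<close> remains of the product,
    which is why its continuity at 0 suffices.\<close>
  let ?F = "\<lambda>u. u *\<^sub>R \<phi> u - real N *\<^sub>R \<phi> u - \<Phi> u"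
  have contF: "continuous_on {real N..real (Suc N)} ?F"
  proof (cases "N = 0")
    case True
    show ?thesis
      using True by (auto intro!: continuous_intros continuous_on_subset[OF cont(1)] continuous_on_subset[OF cont(2)])
  next
    case False
    have "continuous_on {real N..real (Suc N)} \<phi>"
      using False by (intro continuous_at_imp_continuous_on ballI has_vector_derivative_continuous[OF \<phi>]) auto
    then show ?thesis
      by (auto intro!: continuous_intros continuous_on_subset[OF cont(1)])
  qed
  have "((\<lambda>u. (u - real N) *\<^sub>R \<phi>' u) has_integral ?F (real (Suc N)) - ?F (real N)) {real N..real (Suc N)}"
  proof (rule fundamental_theorem_of_calculus_interior[OF _ contF])
    fix u assume "u \<in> {real N<..<real (Suc N)}"
    then have u: "u > 0" by (auto intro: le_less_trans[of 0 "real N"])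
    show "(?F has_vector_derivative (u - real N) *\<^sub>R \<phi>' u) (at u)"
      by (rule derivative_eq_intros \<phi>[OF u] \<Phi>[OF u] refl | simp add: scaleR_diff_left)+
  qed simp
  moreover have "?F (real (Suc N)) - ?F (real N) = \<phi> (real (Suc N)) - \<Phi> (real (Suc N)) + \<Phi> (real N)"
    by (simp add: scaleR_add_left)
  ultimately have "((\<lambda>u. (u - real N) *\<^sub>R \<phi>' u) has_integral
      \<phi> (real (Suc N)) - \<Phi> (real (Suc N)) + \<Phi> (real N)) {real N..real (Suc N)}" by metis
  \<comment> \<open>On a unit interval \<open>frac u\<close> is \<open>u - real N\<close>, except at
    the right endpoint, where it drops to 0; a single point does not change the integral.\<close>
  then have "((\<lambda>u. frac u *\<^sub>R \<phi>' u) has_integral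
      \<phi> (real (Suc N)) - \<Phi> (real (Suc N)) + \<Phi> (real N)) {real N..real (Suc N)}"
  proof (rule has_integral_spike_finite[where S = "{real (Suc N)}", rotated 2])
    fix u assume u: "u \<in> {real N..real (Suc N)} - {real (Suc N)}"
    have "\<lfloor>u\<rfloor> = int N" using u by (intro floor_unique) auto
    then show "frac u *\<^sub>R \<phi>' u = (u - real N) *\<^sub>R \<phi>' u" by (simp add: frac_def)
  qed simp
  from has_integral_combine[OF _ _ Suc.IH this] show ?case
    by (simp add: algebra_simps)
qed

text \<open>Monotone convergence along the cut-offs to \<open>{0<..real N}\<close>. Because the
  integrand is nonnegative, convergence of the gauge integrals already forces absolute
  integrability, so this is the source of integrability as well as of values.\<close>

lemma set_integral_nonneg_limit:
  fixes f :: "real \<Rightarrow> real"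
  assumes nonneg: "\<And>u. u > 0 \<Longrightarrow> f u \<ge> 0"
    and int: "\<And>N. (f has_integral I N) {0..real N}" and lim: "I \<longlonglongrightarrow> c"
    and meas [measurable]: "f \<in> borel_measurable borel"
  shows "set_integrable lborel {0<..} f" "(LINT u:{0<..}|lborel. f u) = c"
proof -
  let ?g = "\<lambda>u. indicator {0<..} u *\<^sub>R f u"
  have *: "((\<lambda>u. indicator {0<..real N} u *\<^sub>R f u) has_integral I N) UNIV" for N
  proof -
    have "(f has_integral I N) {0<..real N}"
      using int[of N] by (subst has_integral_spike_set_eq[where T = "{0..real N}"]) (auto intro: negligible_subset[of "{0}"])
    then show ?thesis
      by (subst (asm) has_integral_restrict_UNIV[symmetric])
         (simp add: indicator_def of_bool_def if_distrib[of "\<lambda>c. c * _"] cong: if_cong)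
  qed
  have "has_bochner_integral lborel (\<lambda>u. indicator {0<..real N} u *\<^sub>R f u) (I N)" for N
  proof (rule has_bochner_integral_nn_integral)
    show "0 \<le> I N" by (rule has_integral_nonneg[OF *]) (auto simp: indicator_def nonneg)
    show "(\<integral>\<^sup>+ u. ennreal (indicator {0<..real N} u *\<^sub>R f u) \<partial>lborel) = ennreal (I N)"
      using nn_integral_has_integral_lebesgue[OF _ *[of N]] by (simp add: nonneg indicator_def)
  qed (auto simp: indicator_def nonneg)
  then have I: "integrable lborel (\<lambda>u. indicator {0<..real N} u *\<^sub>R f u)"
      "(\<integral>u. indicator {0<..real N} u *\<^sub>R f u \<partial>lborel) = I N" for N
    by (auto simp: has_bochner_integral_iff)
  have 1: "AE u in lborel. mono (\<lambda>N. indicator {0<..real N} u *\<^sub>R f u)"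
    using nonneg by (auto intro!: AE_I2 monoI split: split_indicator)
  have 2: "AE u in lborel. (\<lambda>N. indicator {0<..real N} u *\<^sub>R f u) \<longlonglongrightarrow> ?g u"
  proof (rule AE_I2)
    fix u :: real
    have "\<forall>\<^sub>F N in sequentially. indicator {0<..real N} u *\<^sub>R f u = ?g u"
      by (rule eventually_sequentiallyI[of "nat \<lceil>u\<rceil>"]) (auto split: split_indicator simp: nat_le_iff ceiling_le_iff)
    then show "(\<lambda>N. indicator {0<..real N} u *\<^sub>R f u) \<longlonglongrightarrow> ?g u"
      by (rule tendsto_eventually)
  qed
  have 3: "?g \<in> borel_measurable lborel" by measurable
  have 4: "(\<lambda>N. \<integral>u. indicator {0<..real N} u *\<^sub>R f u \<partial>lborel) \<longlonglongrightarrow> c"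
    using lim I(2) by simp
  show "set_integrable lborel {0<..} f" "(LINT u:{0<..}|lborel. f u) = c"
    unfolding set_integrable_def set_lebesgue_integral_def
    using integrable_monotone_convergence[OF I(1) 1 2 4 3] integral_monotone_convergence[OF I(1) 1 2 4 3]
    by auto
qed

text \<open>Counterpart for integrands without a sign: integrability has to be supplied, for
  instance by comparison with a nonnegative function, and then the truncated integrals converge to
  the full one.\<close>

lemma set_integral_limit:
  fixes f :: "real \<Rightarrow> 'a::euclidean_space"
  assumes f: "set_integrable lborel {0<..} f"
    and int: "\<And>N. (f has_integral I N) {0..real N}" and lim: "I \<longlonglongrightarrow> c"
  shows "(LINT u:{0<..}|lborel. f u) = c"
proof -
  have "(LINT u:{0<..real N}|lborel. f u) = I N" for N
  proof -
    have "set_integrable lborel {0<..real N} f"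
      using f by (rule set_integrable_subset) auto
    from set_borel_integral_eq_integral[OF this]
    have "(f has_integral (LINT u:{0<..real N}|lborel. f u)) {0<..real N}"
      by (simp add: has_integral_integrable_integral)
    moreover have "(f has_integral I N) {0<..real N}"
      using int[of N] by (subst has_integral_spike_set_eq[where T = "{0..real N}"]) (auto intro: negligible_subset[of "{0}"])
    ultimately show ?thesis by (rule has_integral_unique)
  qed
  moreover have "((\<lambda>y. LINT u|lborel. indicator {..y} u *\<^sub>R (indicator {0<..} u *\<^sub>R f u)) \<longlongrightarrow>
      (LINT u|lborel. indicator {0<..} u *\<^sub>R f u)) at_top"
    by (rule tendsto_integral_at_top) (use f in \<open>auto simp: set_integrable_def\<close>)
  then have "(\<lambda>N. LINT u|lborel. indicator {..real N} u *\<^sub>R (indicator {0<..} u *\<^sub>R f u)) \<longlonglongrightarrow>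
      (LINT u|lborel. indicator {0<..} u *\<^sub>R f u)"
    by (rule filterlim_compose) (rule filterlim_real_sequentially)
  moreover have "(\<lambda>u. indicator {..real N} u *\<^sub>R (indicator {0<..} u *\<^sub>R f u)) =
      (\<lambda>u. indicator {0<..real N} u *\<^sub>R f u)" for N
    by (auto simp: indicator_def)
  ultimately have "I \<longlonglongrightarrow> (LINT u:{0<..}|lborel. f u)"
    by (simp only: set_lebesgue_integral_def)
  then show ?thesis
    using lim by (rule LIMSEQ_unique)
qed

section \<open>Mellin transforms: scaling and exchange of integrals\<close>

text \<open>Restriction to positive reals keeps the argument of \<open>powr\<close> off the branch
  cut, where the power is continuous. The later measurability proofs therefore attach the indicator
  to the power.\<close>

lemma borel_measurable_powr_indicator [measurable]:
  "(\<lambda>x. indicator {0<..} x *\<^sub>R (complex_of_real x powr s)) \<in> borel_measurable borel"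
  by (intro borel_measurable_continuous_on_indicator continuous_on_powr_complex continuous_intros)
     (auto simp: complex_nonpos_Reals_iff)

text \<open>Substitute \<open>y = c * x\<close>: the power contributes \<open>c powr s\<close> and
  the measure one more factor \<open>c\<close>, and both move to the other side.\<close>

lemma mellin_scale:
  fixes k :: "real \<Rightarrow> real"
  assumes c: "c > 0"
  shows "(LINT x:{0<..}|lborel. of_real x powr s * of_real (k (x * c)) :: complex) =
      of_real c powr (-s - 1) * (LINT x:{0<..}|lborel. of_real x powr s * of_real (k x))"
    and "set_integrable lborel {0<..} (\<lambda>x. of_real x powr s * of_real (k x) :: complex) \<Longrightarrow>
      set_integrable lborel {0<..} (\<lambda>x. of_real x powr s * of_real (k (x * c)) :: complex)"
proof -
  let ?f = "\<lambda>x. indicator {0<..} x *\<^sub>R (of_real x powr s * of_real (k x)) :: complex"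
  let ?g = "\<lambda>x. indicator {0<..} x *\<^sub>R (of_real x powr s * of_real (k (x * c))) :: complex"
  have eq: "?f (0 + c * x) = of_real c powr s * ?g x" for x
    using c by (auto simp: indicator_def powr_times_real mult_ac zero_less_mult_iff)
  have "integral\<^sup>L lborel ?f = c *\<^sub>R (of_real c powr s * integral\<^sup>L lborel ?g)"
    using c by (subst lborel_integral_real_affine[of c _ 0]) (simp_all only: eq integral_mult_right_zero, simp_all)
  then have "integral\<^sup>L lborel ?g = of_real c powr (-s - 1) * integral\<^sup>L lborel ?f"
    using c by (simp add: powr_diff powr_minus scaleR_conv_of_real)
  then show "(LINT x:{0<..}|lborel. of_real x powr s * of_real (k (x * c)) :: complex) =
      of_real c powr (-s - 1) * (LINT x:{0<..}|lborel. of_real x powr s * of_real (k x))"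
    by (simp add: set_lebesgue_integral_def)
  assume "set_integrable lborel {0<..} (\<lambda>x. of_real x powr s * of_real (k x) :: complex)"
  then have "integrable lborel ?f" by (simp add: set_integrable_def)
  then have "integrable lborel (\<lambda>x. ?f (0 + c * x))"
    using c by (intro lborel_integrable_real_affine) auto
  then have "integrable lborel (\<lambda>x. of_real c powr s * ?g x)"
    unfolding eq .
  then have "integrable lborel (\<lambda>x. inverse (of_real c powr s) * (of_real c powr s * ?g x))"
    by (rule integrable_mult_right)
  then show "set_integrable lborel {0<..} (\<lambda>x. of_real x powr s * of_real (k (x * c)) :: complex)"
    using c by (simp add: set_integrable_def mult.assoc[symmetric])
qed

text \<open>By Fubini the integral over \<open>x\<close> can be taken first; scaling turns it into
  the Mellin transform of \<open>k\<close> times a power of \<open>c u\<close>, so the double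
  integral factors. The function \<open>c\<close> is a parameter because both \<open>c u = u\<close>
  and \<open>c u = 1 / u\<close> occur in the reflection argument.\<close>

lemma mellin_swap:
  fixes k w c :: "real \<Rightarrow> real" and s :: complex
  assumes [measurable]: "k \<in> borel_measurable borel" "w \<in> borel_measurable borel" "c \<in> borel_measurable borel"
    and nonneg: "\<And>x. x > 0 \<Longrightarrow> k x \<ge> 0" "\<And>u. u > 0 \<Longrightarrow> w u \<ge> 0" and c: "\<And>u. u > 0 \<Longrightarrow> c u > 0"
    and int_k: "set_integrable lborel {0<..} (\<lambda>x. x powr Re s * k x)"
    and int_w: "set_integrable lborel {0<..} (\<lambda>u. w u * c u powr (- Re s - 1))"
  shows "(LINT x:{0<..}|lborel. of_real x powr s * of_real (LINT u:{0<..}|lborel. w u * k (x * c u))) =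
      (LINT u:{0<..}|lborel. of_real (w u) * of_real (c u) powr (-s - 1)) *
      (LINT x:{0<..}|lborel. of_real x powr s * of_real (k x) :: complex)"
proof -
  define F :: "real \<Rightarrow> real \<Rightarrow> complex" where
    "F u x = indicator {0<..} u *\<^sub>R (indicator {0<..} x *\<^sub>R (of_real x powr s)) *
       of_real (w u * k (x * c u))" for u x
  have normF: "norm (F u x) = indicator {0<..} u * w u * (indicator {0<..} x * (x powr Re s * k (x * c u)))" for u x
    using nonneg c by (auto simp: F_def indicator_def norm_mult norm_powr_real_powr)
  have meas: "case_prod F \<in> borel_measurable (lborel \<Otimes>\<^sub>M lborel)"
    unfolding F_def by measurable
  have int_k': "set_integrable lborel {0<..} (\<lambda>x. of_real x powr s * of_real (k x) :: complex)"
  proof -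
    have "integrable lborel (\<lambda>x. (indicator {0<..} x *\<^sub>R (of_real x powr s)) * of_real (k x) :: complex)"
      by (rule Bochner_Integration.integrable_bound[OF int_k[unfolded set_integrable_def]])
         (auto simp: indicator_def norm_mult norm_powr_real_powr nonneg)
    then show ?thesis by (simp add: set_integrable_def)
  qed
  have F_eq: "F u = (\<lambda>x. (indicator {0<..} u * w u) *\<^sub>R
      (indicator {0<..} x *\<^sub>R (of_real x powr s * of_real (k (x * c u)))))" for u
    by (auto simp: F_def fun_eq_iff indicator_def scaleR_conv_of_real)
  have intF: "integrable lborel (F u)" for u
  proof (cases "u > 0")
    case True
    then show ?thesis
      unfolding F_eq using mellin_scale(2)[OF c int_k', of u]
      by (intro integrable_scaleR_right) (simp add: set_integrable_def)
  qed (simp add: F_def[abs_def])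
  have abs_int: "(LINT x|lborel. norm (F u x)) =
      indicator {0<..} u *\<^sub>R (w u * c u powr (- Re s - 1)) * (LINT x:{0<..}|lborel. x powr Re s * k x)" for u
  proof (cases "u > 0")
    case True
    \<comment> \<open>The scaling rule is complex-valued, so the real identity with exponent
      \<open>Re s\<close> is embedded into the complex numbers and recovered at the end by
      injectivity of \<open>of_real\<close>.\<close>
    have "complex_of_real (LINT x:{0<..}|lborel. x powr Re s * k (x * c u)) =
        (LINT x:{0<..}|lborel. of_real x powr of_real (Re s) * of_real (k (x * c u)))"
      unfolding set_lebesgue_integral_def
      by (subst integral_complex_of_real[symmetric], rule Bochner_Integration.integral_cong)
         (auto simp: indicator_def powr_of_real)
    also have "\<dots> = of_real (c u) powr (- of_real (Re s) - 1) *
        (LINT x:{0<..}|lborel. of_real x powr of_real (Re s) * of_real (k x))"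
      by (rule mellin_scale(1)[OF c[OF True]])
    also have "(LINT x:{0<..}|lborel. of_real x powr of_real (Re s) * of_real (k x)) =
        complex_of_real (LINT x:{0<..}|lborel. x powr Re s * k x)"
      unfolding set_lebesgue_integral_def
      by (subst integral_complex_of_real[symmetric], rule Bochner_Integration.integral_cong)
         (auto simp: indicator_def powr_of_real)
    also have "of_real (c u) powr (- of_real (Re s) - 1) = complex_of_real (c u powr (- Re s - 1))"
      using c[OF True] by (simp flip: powr_of_real)
    finally have "(LINT x:{0<..}|lborel. x powr Re s * k (x * c u)) =
        c u powr (- Re s - 1) * (LINT x:{0<..}|lborel. x powr Re s * k x)"
      by (simp only: of_real_mult[symmetric] of_real_eq_iff)
    then show ?thesis
      using True by (simp add: normF set_lebesgue_integral_def)
  qed (simp add: normF)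
  have "integrable (lborel \<Otimes>\<^sub>M lborel) (case_prod F)"
    using int_w meas intF unfolding set_integrable_def
    by (intro lborel_pair.Fubini_integrable) (simp_all add: abs_int)
  from lborel_pair.Fubini_integral[OF this]
  have "(LINT x|lborel. LINT u|lborel. F u x) = (LINT u|lborel. LINT x|lborel. F u x)" .
  also have "(LINT x|lborel. LINT u|lborel. F u x) =
      (LINT x:{0<..}|lborel. of_real x powr s * of_real (LINT u:{0<..}|lborel. w u * k (x * c u)))"
    unfolding set_lebesgue_integral_def
  proof (rule Bochner_Integration.integral_cong[OF refl])
    fix x :: real
    have "F u x = (indicator {0<..} x *\<^sub>R (of_real x powr s)) *
        complex_of_real (indicator {0<..} u *\<^sub>R (w u * k (x * c u)))" for u
      by (auto simp: F_def indicator_def)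
    then show "(LINT u|lborel. F u x) = indicator {0<..} x *\<^sub>R
        (of_real x powr s * of_real (LINT u|lborel. indicator {0<..} u *\<^sub>R (w u * k (x * c u))))"
      by (simp only: integral_mult_right_zero integral_complex_of_real) simp
  qed
  also have "(LINT u|lborel. LINT x|lborel. F u x) =
      (LINT u|lborel. indicator {0<..} u *\<^sub>R (of_real (w u) * of_real (c u) powr (-s - 1)) *
        (LINT x:{0<..}|lborel. of_real x powr s * of_real (k x)))"
  proof (rule Bochner_Integration.integral_cong[OF refl])
    fix u :: real
    show "(LINT x|lborel. F u x) = indicator {0<..} u *\<^sub>R (of_real (w u) * of_real (c u) powr (-s - 1)) *
        (LINT x:{0<..}|lborel. of_real x powr s * of_real (k x))"
    proof (cases "u > 0")
      case True
      show ?thesis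
        using mellin_scale(1)[OF c[OF True], of s k] True
        by (simp add: F_eq set_lebesgue_integral_def scaleR_conv_of_real)
    qed (simp add: F_def)
  qed
  also have "\<dots> = (LINT u:{0<..}|lborel. of_real (w u) * of_real (c u) powr (-s - 1)) *
      (LINT x:{0<..}|lborel. of_real x powr s * of_real (k x))"
    unfolding set_lebesgue_integral_def by (rule integral_mult_left_zero)
  finally show ?thesis .
qed

section \<open>Partial fractions of the cotangent and of \<open>1 / (exp x - 1)\<close>\<close>

text \<open>Differentiating the reflection formula for \<open>rGamma z * rGamma (- z)\<close> in two
  ways expresses \<open>Digamma (-z) - Digamma z\<close> through the cotangent. In the limit formula
  for \<open>Digamma\<close> the logarithms cancel in this difference, which leaves the partial
  sums.\<close>

lemma pi_cot_partial_fraction: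
  fixes z :: complex
  assumes z: "z \<notin> \<int>"
  shows "(\<lambda>N. \<Sum>n=1..N. 2 * z / (z\<^sup>2 - of_nat n ^ 2)) \<longlonglongrightarrow> of_real pi * cot (of_real pi * z) - 1 / z"
proof -
  have z0: "z \<noteq> 0" using z by auto
  have nz: "z \<notin> \<int>\<^sub>\<le>\<^sub>0" "-z \<notin> \<int>\<^sub>\<le>\<^sub>0"
    using z nonpos_Ints_subset_Ints by (auto dest!: subsetD)
  have sin0: "sin (of_real pi * z) \<noteq> 0"
    using z by (auto simp: sin_eq_0 mult.commute[of pi])
  have rG: "rGamma z \<noteq> 0" "rGamma (-z) \<noteq> 0" using nz by (auto simp: rGamma_eq_zero_iff)
  have "((\<lambda>z. rGamma z * rGamma (- z)) has_field_derivative
      - rGamma z * rGamma (-z) * (Digamma z - Digamma (-z))) (at z)"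
    using nz by (auto intro!: derivative_eq_intros simp: algebra_simps)
  moreover have "(\<lambda>z. rGamma z * rGamma (- z)) = (\<lambda>z. - z * sin (of_real pi * z) / complex_of_real pi)"
    by (intro ext rGamma_reflection_complex')
  moreover have "((\<lambda>z. - z * sin (of_real pi * z) / complex_of_real pi) has_field_derivative
      - (sin (of_real pi * z) + z * of_real pi * cos (of_real pi * z)) / of_real pi) (at z)"
    by (auto intro!: derivative_eq_intros simp: field_simps)
  ultimately have "- rGamma z * rGamma (-z) * (Digamma z - Digamma (-z)) =
      - (sin (of_real pi * z) + z * of_real pi * cos (of_real pi * z)) / of_real pi"
    by (metis DERIV_unique)
  then have "z * sin (of_real pi * z) * (Digamma (-z) - Digamma z) =
      sin (of_real pi * z) + z * of_real pi * cos (of_real pi * z)"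
    using rGamma_reflection_complex'[of z] by (simp add: field_simps)
  then have dig: "Digamma (-z) - Digamma z = 1 / z + of_real pi * cot (of_real pi * z)"
    using z0 sin0 by (simp add: cot_def field_simps)
  have "(\<lambda>m. (of_real (ln (real m)) - (\<Sum>n<m. inverse (-z + of_nat n))) -
      (of_real (ln (real m)) - (\<Sum>n<m. inverse (z + of_nat n)))) \<longlonglongrightarrow> Digamma (-z) - Digamma z"
    using z0 by (intro tendsto_diff Digamma_LIMSEQ) auto
  then have "(\<lambda>m. (\<Sum>n<m. inverse (z + of_nat n)) - (\<Sum>n<m. inverse (-z + of_nat n)))
      \<longlonglongrightarrow> Digamma (-z) - Digamma z"
    by (simp only: diff_diff_eq2 diff_add_eq diff_diff_eq add_diff_cancel_left) simp
  \<comment> \<open>With \<open>Suc m\<close> terms the index runs from 0 to \<open>m\<close>; the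
    term at 0 is \<open>2 / z\<close>, and the others form the sum over \<open>1..m\<close>.\<close>
  then have "(\<lambda>m. (\<Sum>n<Suc m. inverse (z + of_nat n)) - (\<Sum>n<Suc m. inverse (-z + of_nat n)))
      \<longlonglongrightarrow> Digamma (-z) - Digamma z"
    by (rule LIMSEQ_Suc)
  moreover have "(\<Sum>n<Suc m. inverse (z + of_nat n)) - (\<Sum>n<Suc m. inverse (-z + of_nat n)) =
      2 / z + (\<Sum>n=1..m. 2 * z / (z\<^sup>2 - of_nat n ^ 2))" for m
  proof -
    have *: "inverse (z + of_nat n) - inverse (-z + of_nat n) = 2 * z / (z\<^sup>2 - of_nat n ^ 2)" for n
    proof -
      have "z \<noteq> of_nat n" "z \<noteq> - of_nat n" using z by auto
      then have nz: "z - of_nat n \<noteq> 0" "z + of_nat n \<noteq> 0" by (auto simp: add_eq_0_iff2)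
      have "inverse (-z + of_nat n) = - inverse (z - of_nat n)"
        by (simp flip: inverse_minus_eq)
      then have "inverse (z + of_nat n) - inverse (-z + of_nat n) =
          inverse (z + of_nat n) + inverse (z - of_nat n)" by simp
      also have "\<dots> = ((z - of_nat n) + (z + of_nat n)) * inverse ((z - of_nat n) * (z + of_nat n))"
      proof -
        have "inverse a + inverse b = (b + a) * inverse (b * a)" if "a \<noteq> 0" "b \<noteq> 0" for a b :: complex
          using that by (simp add: field_simps)
        from this[OF nz(2,1)] show ?thesis .
      qed
      also have "(z - of_nat n) * (z + of_nat n) = z\<^sup>2 - of_nat n ^ 2"
        by (simp add: algebra_simps power2_eq_square)
      finally show ?thesis by (simp add: divide_inverse)
    qed
    have "(\<Sum>n<Suc m. inverse (z + of_nat n)) - (\<Sum>n<Suc m. inverse (-z + of_nat n)) =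
        (\<Sum>n<Suc m. 2 * z / (z\<^sup>2 - of_nat n ^ 2))"
      by (simp only: sum_subtractf[symmetric] *)
    also have "\<dots> = (\<Sum>n\<in>insert 0 {1..m}. 2 * z / (z\<^sup>2 - of_nat n ^ 2))"
      by (rule sum.cong) auto
    also have "\<dots> = 2 / z + (\<Sum>n=1..m. 2 * z / (z\<^sup>2 - of_nat n ^ 2))"
      using z0 by (subst sum.insert) (simp_all add: power2_eq_square)
    finally show ?thesis .
  qed
  ultimately have "(\<lambda>m. 2 / z + (\<Sum>n=1..m. 2 * z / (z\<^sup>2 - of_nat n ^ 2))) \<longlonglongrightarrow>
      1 / z + of_real pi * cot (of_real pi * z)"
    unfolding dig by simp
  from tendsto_diff[OF this tendsto_const[of "2 / z"]] show ?thesis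
    by (simp add: algebra_simps diff_divide_distrib[symmetric])
qed

text \<open>The cotangent expansion on the imaginary axis, at
  \<open>z = \<i> * x / (2 * pi)\<close>: there the cotangent becomes a hyperbolic one, and
  \<open>coth (x / 2) = 1 + 2 / (exp x - 1)\<close>.\<close>

lemma coth_partial_fraction:
  fixes x :: real
  assumes x: "x > 0"
  shows "(\<lambda>N. \<Sum>n=1..N. 2 * x / (x\<^sup>2 + 4 * pi\<^sup>2 * (real n)\<^sup>2)) \<longlonglongrightarrow> 1 / (exp x - 1) - 1 / x + 1 / 2"
proof -
  define z where "z = \<i> * of_real (x / (2 * pi))"
  have z: "z \<notin> \<int>"
  proof
    assume "z \<in> \<int>"
    then have "Im z = 0" by (auto elim!: Ints_cases)
    then show False using x by (simp add: z_def)
  qed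
  have "complex_of_real (exp x) \<noteq> of_real 1" using x by (subst of_real_eq_iff) simp
  then have e1: "exp (complex_of_real x) \<noteq> 1" by (simp add: exp_of_real)
  have "complex_of_real pi * z = \<i> * of_real (x / 2)" using x by (simp add: z_def)
  moreover have "\<i> * cot (\<i> * complex_of_real (x / 2)) = 1 + 2 / (exp (of_real x) - 1)"
  proof -
    have ex: "exp (complex_of_real x) = exp (complex_of_real x / 2) * exp (complex_of_real x / 2)"
      by (simp flip: exp_add)
    have "exp (complex_of_real x / 2) * exp (complex_of_real x / 2) \<noteq> 1" using e1 ex by simp
    then show ?thesis
      unfolding cot_def sin_exp_eq cos_exp_eq ex
      by (simp add: exp_minus field_simps) 
  qed
  ultimately have cot: "\<i> * cot (complex_of_real pi * z) = 1 + 2 / (exp (of_real x) - 1)"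
    by metis
  \<comment> \<open>The factor \<open>\<i> / (2 * pi)\<close> makes every term real, so the complex
    limit descends to a real one.\<close>
  have "(\<lambda>N. \<i> / (2 * pi) * (\<Sum>n=1..N. 2 * z / (z\<^sup>2 - of_nat n ^ 2))) \<longlonglongrightarrow>
      \<i> / (2 * pi) * (of_real pi * cot (of_real pi * z) - 1 / z)"
    by (intro tendsto_mult tendsto_const pi_cot_partial_fraction z)
  moreover have "\<i> / (2 * pi) * (\<Sum>n=1..N. 2 * z / (z\<^sup>2 - of_nat n ^ 2)) =
      of_real (\<Sum>n=1..N. 2 * x / (x\<^sup>2 + 4 * pi\<^sup>2 * (real n)\<^sup>2))" for N
  proof -
    have "\<i> / (2 * pi) * (2 * z / (z\<^sup>2 - of_nat n ^ 2)) =
        complex_of_real (2 * x / (x\<^sup>2 + 4 * pi\<^sup>2 * (real n)\<^sup>2))" for n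
    proof -
      have "x\<^sup>2 + 4 * pi\<^sup>2 * (real n)\<^sup>2 > 0" using x by (intro add_pos_nonneg) auto
      have zz: "z\<^sup>2 - of_nat n ^ 2 = - complex_of_real ((x\<^sup>2 + 4 * pi\<^sup>2 * (real n)\<^sup>2) / (4 * pi\<^sup>2))"
        by (simp add: z_def power_mult_distrib power_divide field_simps)
      have "\<i> * (2 * z) = - complex_of_real (x / pi)" by (simp add: z_def)
      have "\<i> / (2 * pi) * (2 * z / (z\<^sup>2 - of_nat n ^ 2)) =
          (\<i> * (2 * z)) / complex_of_real (2 * pi) / (z\<^sup>2 - of_nat n ^ 2)" by simp
      also have "\<dots> = - complex_of_real (x / pi) / complex_of_real (2 * pi) /
          (- complex_of_real ((x\<^sup>2 + 4 * pi\<^sup>2 * (real n)\<^sup>2) / (4 * pi\<^sup>2)))"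
        by (simp only: zz \<open>\<i> * (2 * z) = - complex_of_real (x / pi)\<close>)
      also have "\<dots> = complex_of_real ((x / pi) / (2 * pi) / ((x\<^sup>2 + 4 * pi\<^sup>2 * (real n)\<^sup>2) / (4 * pi\<^sup>2)))"
        by (simp only: of_real_divide minus_divide_left[symmetric] minus_divide_right[symmetric] minus_minus)
      also have "(x / pi) / (2 * pi) / ((x\<^sup>2 + 4 * pi\<^sup>2 * (real n)\<^sup>2) / (4 * pi\<^sup>2)) =
         2 * x / (x\<^sup>2 + 4 * pi\<^sup>2 * (real n)\<^sup>2)"
        by (simp add: field_simps power2_eq_square)
      finally show ?thesis .
    qed
    then show ?thesis by (simp only: sum_distrib_left of_real_sum)
  qed
  moreover have "\<i> / (2 * pi) * (of_real pi * cot (of_real pi * z) - 1 / z) =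
      complex_of_real (1 / (exp x - 1) - 1 / x + 1 / 2)"
  proof -
    have "\<i> / (2 * pi) * (of_real pi * cot (of_real pi * z) - 1 / z) =
        (\<i> * cot (of_real pi * z)) / 2 - \<i> / (2 * pi * z)"
      by (simp add: field_simps)
    also have "\<i> / (2 * pi * z) = 1 / complex_of_real x" using x by (simp add: z_def)
    finally have "\<i> / (2 * pi) * (of_real pi * cot (of_real pi * z) - 1 / z) =
        (1 + 2 / (exp (of_real x) - 1)) / 2 - 1 / complex_of_real x" unfolding cot .
    moreover have "(1 + 2 / w) / 2 = 1 / w + 1 / 2" for w :: complex
      by (cases "w = 0") (simp_all add: field_simps)
    ultimately show ?thesis by (simp flip: exp_of_real)
  qed
  ultimately show ?thesis
    by (simp only: tendsto_of_real_iff)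
qed

section \<open>Convergence of \<open>H N\<close> to zeta\<close>

lemma has_vector_derivative_powr_of_real:
  assumes "u > 0"
  shows "((\<lambda>u. complex_of_real u powr s) has_vector_derivative s * of_real u powr (s - 1)) (at u)"
proof -
  have "((\<lambda>z. z powr s) has_field_derivative s * of_real u powr (s - 1)) (at (complex_of_real u))"
    using assms by (intro has_field_derivative_powr) (simp add: complex_nonpos_Reals_iff)
  from has_vector_derivative_real_field[OF this] show ?thesis .
qed

lemma H_eq: "s \<noteq> 1 \<Longrightarrow> H N s = (\<Sum>n=1..N. of_nat n powr (-s)) - of_nat N powr (1 - s) / (1 - s)"
  by (simp add: H_def divide_simps) (simp add: algebra_simps)

text \<open>Euler-Maclaurin with \<open>\<phi> u = u powr (-s)\<close>. The antiderivative
  \<open>u powr (1 - s) / (1 - s)\<close> is continuous at 0 with value 0 there because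
  \<open>Re s < 1\<close>; hence no constant is left beside \<open>H N s\<close>.\<close>

lemma has_integral_H:
  assumes s: "0 < Re s" "Re s < 1"
  shows "((\<lambda>u. of_real (frac u) * of_real u powr (-s - 1)) has_integral (- 1 / s) * H N s) {0..real N}"
proof -
  have s0: "s \<noteq> 0" "s \<noteq> 1" using s by auto
  have "((\<lambda>u. frac u *\<^sub>R (- s * of_real u powr (-s - 1))) has_integral
      (\<Sum>n=1..N. of_real (real n) powr (-s)) - of_real (real N) powr (1 - s) / (1 - s) +
      of_real 0 powr (1 - s) / (1 - s)) {0..real N}"
  proof (rule has_integral_frac)
    show "continuous_on {0..} (\<lambda>u. complex_of_real u powr (1 - s) / (1 - s))"
      using s s0 by (intro continuous_intros continuous_on_powr_complex) auto
    have "continuous_on {0..} (\<lambda>u. complex_of_real u powr (1 - s))"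
      using s by (intro continuous_intros continuous_on_powr_complex) auto
    moreover have "u *\<^sub>R complex_of_real u powr (-s) = complex_of_real u powr (1 - s)" for u
      by (simp add: powr_diff powr_minus scaleR_conv_of_real divide_simps)
    ultimately show "continuous_on {0..} (\<lambda>u. u *\<^sub>R complex_of_real u powr (-s))" by simp
    fix u :: real assume u: "u > 0"
    show "((\<lambda>u. complex_of_real u powr (-s)) has_vector_derivative - s * of_real u powr (-s - 1)) (at u)"
      by (rule has_vector_derivative_powr_of_real[OF u])
    show "((\<lambda>u. complex_of_real u powr (1 - s) / (1 - s)) has_vector_derivative of_real u powr (-s)) (at u)"
      using has_vector_derivative_divide[OF has_vector_derivative_powr_of_real[OF u, of "1 - s"], of "1 - s"] s0
      by simp
  qed
  then have "((\<lambda>u. frac u *\<^sub>R (- s * of_real u powr (-s - 1))) has_integral H N s) {0..real N}"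
    by (simp add: H_eq s0)
  from has_integral_mult_right[OF this, of "- 1 / s"] show ?thesis
    using s0 by (simp add: scaleR_conv_of_real mult_ac)
qed

text \<open>The increment is an integral over \<open>[n, n+1]\<close> with a factor
  \<open>u - real n\<close> of size at most 1. This interval avoids 0, so the bound also covers
  \<open>Re s \<ge> 1\<close>; its exponent is below -1, which makes the increments
  summable.\<close>

lemma norm_H_diff_le:
  assumes s: "0 < Re s" "s \<noteq> 1" and n: "n > 0"
  shows "norm (H (Suc n) s - H n s) \<le> norm s * real n powr (- Re s - 1)"
proof -
  let ?F = "\<lambda>u. (u - real n) *\<^sub>R complex_of_real u powr (-s) - complex_of_real u powr (1 - s) / (1 - s)"
  have "((\<lambda>u. (u - real n) *\<^sub>R (- s * of_real u powr (-s - 1))) has_integral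
      ?F (real (Suc n)) - ?F (real n)) {real n..real (Suc n)}"
  proof (rule fundamental_theorem_of_calculus)
    fix u assume "u \<in> {real n..real (Suc n)}"
    then have u: "u > 0" using n by auto
    have "((\<lambda>u. complex_of_real u powr (1 - s) / (1 - s)) has_vector_derivative of_real u powr (-s)) (at u)"
      using has_vector_derivative_divide[OF has_vector_derivative_powr_of_real[OF u, of "1 - s"], of "1 - s"] s
      by simp
    moreover have "((\<lambda>u. u - real n) has_field_derivative 1) (at u)"
      by (auto intro!: derivative_eq_intros)
    ultimately have "(?F has_vector_derivative (u - real n) *\<^sub>R (- s * of_real u powr (-s - 1))
        + 1 *\<^sub>R of_real u powr (-s) - of_real u powr (-s)) (at u)"
      by (intro has_vector_derivative_diff has_vector_derivative_scaleR has_vector_derivative_powr_of_real u)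
    then have "(?F has_vector_derivative (u - real n) *\<^sub>R (- s * of_real u powr (-s - 1))) (at u)"
      by (simp only: scaleR_one add_diff_cancel_right')
    then show "(?F has_vector_derivative (u - real n) *\<^sub>R (- s * of_real u powr (-s - 1)))
        (at u within {real n..real (Suc n)})"
      by (rule has_vector_derivative_at_within)
  qed simp
  moreover have "?F (real (Suc n)) - ?F (real n) = H (Suc n) s - H n s"
    using s by (simp add: H_eq algebra_simps)
  ultimately have "((\<lambda>u. (u - real n) *\<^sub>R (- s * of_real u powr (-s - 1))) has_integral
      H (Suc n) s - H n s) (cbox (real n) (real (Suc n)))" by simp
  moreover have "norm ((u - real n) *\<^sub>R (- s * of_real u powr (-s - 1))) \<le> norm s * real n powr (- Re s - 1)"
    if u: "u \<in> cbox (real n) (real (Suc n))" for u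
  proof -
    have "\<bar>u - real n\<bar> * (norm s * u powr (- Re s - 1)) \<le> 1 * (norm s * real n powr (- Re s - 1))"
      using u n s by (intro mult_mono powr_mono2') auto
    then show ?thesis using u n by (simp add: norm_mult norm_powr_real_powr)
  qed
  ultimately have "norm (H (Suc n) s - H n s) \<le>
      norm s * real n powr (- Re s - 1) * measure lborel (cbox (real n) (real (Suc n)))"
    by (intro has_integral_bound) auto
  then show ?thesis by simp
qed

text \<open>Weierstrass M-test for the telescoping series of increments. The least real part on
  \<open>K\<close> gives the slowest decay, hence a majorant for all of \<open>K\<close>. The limit
  is called \<open>lim\<close> since it has yet to be identified with zeta.\<close>

lemma uniform_limit_H_lim:
  assumes K: "compact K" "K \<subseteq> {s. Re s > 0} - {1}"
  shows "uniform_limit K H (\<lambda>s. lim (\<lambda>N. H N s)) sequentially"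
proof (cases "K = {}")
  case False
  obtain s0 where s0: "s0 \<in> K" "\<And>s. s \<in> K \<Longrightarrow> Re s0 \<le> Re s"
    using continuous_attains_inf[OF K(1) False, of Re] continuous_on_Re[OF continuous_on_id] by blast
  obtain B where B: "\<And>s. s \<in> K \<Longrightarrow> norm s \<le> B"
    using compact_imp_bounded[OF K(1)] by (auto simp: bounded_iff)
  \<comment> \<open>The telescoping starts at \<open>H 1\<close>, since the increment bound requires
    a positive index.\<close>
  define f where "f n s = H (Suc (Suc n)) s - H (Suc n) s" for n s
  have "summable (\<lambda>n. real (Suc n) powr (- Re s0 - 1))"
    using s0 K by (subst summable_Suc_iff) (auto simp: summable_real_powr_iff)
  then have sum: "summable (\<lambda>n. B * real (Suc n) powr (- Re s0 - 1))"
    by (rule summable_mult)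
  have "norm (f n s) \<le> B * real (Suc n) powr (- Re s0 - 1)" if s: "s \<in> K" for n s
  proof -
    have "norm (f n s) \<le> norm s * real (Suc n) powr (- Re s - 1)"
      unfolding f_def using s K by (intro norm_H_diff_le) auto
    also have "\<dots> \<le> B * real (Suc n) powr (- Re s0 - 1)"
      using B[OF s] s0(2)[OF s] by (intro mult_mono powr_mono order_trans[OF norm_ge_zero B[OF s]]) auto
    finally show ?thesis .
  qed
  then have "uniform_limit K (\<lambda>n s. \<Sum>i<n. f i s) (\<lambda>s. \<Sum>i. f i s) sequentially"
    by (rule Weierstrass_m_test[OF _ sum])
  moreover have "(\<Sum>i<n. f i s) = H (Suc n) s - H 1 s" for n s
    unfolding f_def by (subst sum_lessThan_telescope) simp
  ultimately have "uniform_limit K (\<lambda>n s. H 1 s + (H (Suc n) s - H 1 s)) (\<lambda>s. H 1 s + (\<Sum>i. f i s)) sequentially"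
    by (intro uniform_limit_intros) simp
  then have "uniform_limit K (\<lambda>n. H (Suc n)) (\<lambda>s. H 1 s + (\<Sum>i. f i s)) sequentially"
    by simp
  then have u: "uniform_limit K H (\<lambda>s. H 1 s + (\<Sum>i. f i s)) sequentially"
    unfolding filterlim_sequentially_Suc[of H] .
  moreover have "H 1 s + (\<Sum>i. f i s) = lim (\<lambda>N. H N s)" if "s \<in> K" for s
    using tendsto_uniform_limitI[OF u that] by (simp add: limI)
  ultimately show ?thesis by (simp cong: uniform_limit_cong')
qed (simp add: uniform_limit_on_empty)

lemma holomorphic_on_H [holomorphic_intros]: "1 \<notin> A \<Longrightarrow> H N holomorphic_on A"
  unfolding H_def[abs_def] by (intro holomorphic_intros) auto

text \<open>A locally uniform limit of holomorphic functions is holomorphic. For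
  \<open>Re s > 1\<close> the correction term in \<open>H N s\<close> tends to 0, which leaves the
  Dirichlet series.\<close>

lemma continues_zeta_lim_H: "continues_zeta 0 (\<lambda>s. lim (\<lambda>N. H N s))"
  unfolding continues_zeta_def
proof (intro conjI allI impI)
  let ?S = "{s. Re s > 0} - {1::complex}"
  have S: "open ?S" by (intro open_delete open_halfspace_Re_gt)
  show "(\<lambda>s. lim (\<lambda>N. H N s)) holomorphic_on ?S"
  proof (rule holomorphic_uniform_sequence[OF S, of H])
    fix s assume "s \<in> ?S"
    then obtain d where "d > 0" "cball s d \<subseteq> ?S" using S open_contains_cball by blast
    then show "\<exists>d>0. cball s d \<subseteq> ?S \<and> uniform_limit (cball s d) H (\<lambda>s. lim (\<lambda>N. H N s)) sequentially"
      using uniform_limit_H_lim[of "cball s d"] by auto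
  qed (auto intro: holomorphic_on_H)
  fix s :: complex assume s: "Re s > 1"
  have "(\<lambda>N. H N s) \<longlonglongrightarrow> lim (\<lambda>N. H N s)"
    by (rule tendsto_uniform_limitI[OF uniform_limit_H_lim[of "{s}"]]) (use s in auto)
  moreover have "(\<lambda>N. of_nat N powr (1 - s) / (s - 1)) \<longlonglongrightarrow> 0"
  proof (rule tendsto_divide_zero)
    have "(\<lambda>N. real N powr (1 - Re s)) \<longlonglongrightarrow> 0"
      using s by (intro tendsto_neg_powr filterlim_real_sequentially) auto
    then show "(\<lambda>N. of_nat N powr (1 - s)) \<longlonglongrightarrow> 0"
      by (rule Lim_null_comparison[rotated]) (auto simp: norm_powr_real_powr intro!: eventually_sequentiallyI[of 1])
  qed
  ultimately have "(\<lambda>N. H N s - of_nat N powr (1 - s) / (s - 1)) \<longlonglongrightarrow> lim (\<lambda>N. H N s) - 0"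
    by (rule tendsto_diff)
  moreover have "H N s - of_nat N powr (1 - s) / (s - 1) = (\<Sum>n<N. of_nat (Suc n) powr (-s))" for N
    unfolding H_def by (simp add: sum.atLeast1_atMost_eq)
  ultimately show "(\<lambda>n. of_nat (Suc n) powr (-s)) sums lim (\<lambda>N. H N s)"
    unfolding sums_def by simp
qed

lemma zeta_eq_lim_H: "Re s > 0 \<Longrightarrow> s \<noteq> 1 \<Longrightarrow> zeta s = lim (\<lambda>N. H N s)"
  by (rule zeta_eqI[OF continues_zeta_lim_H])

lemma uniform_limit_H:
  assumes K: "compact K" "K \<subseteq> {s. Re s > 0} - {1}"
  shows "uniform_limit K H zeta sequentially"
proof -
  have "lim (\<lambda>N. H N s) = zeta s" if "s \<in> K" for s
    using K that by (intro zeta_eq_lim_H[symmetric]) auto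
  then show ?thesis using uniform_limit_H_lim[OF K] by (simp cong: uniform_limit_cong')
qed

lemma H_tendsto_zeta: "Re s > 0 \<Longrightarrow> s \<noteq> 1 \<Longrightarrow> (\<lambda>N. H N s) \<longlonglongrightarrow> zeta s"
  by (rule tendsto_uniform_limitI[OF uniform_limit_H[of "{s}"]]) auto

lemma holomorphic_on_zeta: "zeta holomorphic_on {s. Re s > 0} - {1}"
proof -
  have "(\<lambda>s. lim (\<lambda>N. H N s)) holomorphic_on {s. Re s > 0} - {1}"
    using continues_zeta_lim_H by (simp add: continues_zeta_def)
  then show ?thesis by (rule holomorphic_transform) (auto simp: zeta_eq_lim_H)
qed

section \<open>Integrals of the fractional part against powers, exponentials and rational
  kernels\<close>

text \<open>At the real point \<open>\<sigma>\<close> the integrand is nonnegative and its truncated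
  integrals are multiples of \<open>H N\<close>, which converge; monotone convergence then yields
  integrability.\<close>

lemma set_integrable_frac_powr:
  fixes \<sigma> :: real
  assumes \<sigma>: "0 < \<sigma>" "\<sigma> < 1"
  shows "set_integrable lborel {0<..} (\<lambda>u. frac u * u powr (-\<sigma> - 1))"
proof (rule set_integral_nonneg_limit(1))
  let ?I = "\<lambda>N. Re (- 1 / of_real \<sigma> * H N (of_real \<sigma>))"
  show "((\<lambda>u. frac u * u powr (-\<sigma> - 1)) has_integral ?I N) {0..real N}" for N
  proof (rule has_integral_eq)
    have "((\<lambda>u. of_real (frac u) * of_real u powr (- of_real \<sigma> - 1)) has_integral
        (- 1 / of_real \<sigma>) * H N (of_real \<sigma>)) {0..real N}"
      using \<sigma> by (intro has_integral_H) auto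
    from has_integral_linear[OF this bounded_linear_Re]
    show "((\<lambda>u. Re (of_real (frac u) * of_real u powr (- of_real \<sigma> - 1))) has_integral ?I N) {0..real N}"
      by (simp only: o_def)
    fix u assume "u \<in> {0..real N}"
    then have "of_real u powr (- of_real \<sigma> - 1) = complex_of_real (u powr (-\<sigma> - 1))"
      by (simp flip: powr_of_real)
    then show "Re (of_real (frac u) * of_real u powr (- of_real \<sigma> - 1)) = frac u * u powr (-\<sigma> - 1)"
      by simp
  qed
  show "?I \<longlonglongrightarrow> Re (- 1 / of_real \<sigma> * zeta (of_real \<sigma>))"
    using \<sigma> by (intro tendsto_Re tendsto_mult tendsto_const H_tendsto_zeta) auto
  show "(\<lambda>u. frac u * u powr (-\<sigma> - 1)) \<in> borel_measurable borel"
    unfolding frac_def by measurable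
qed auto

text \<open>The norm of the integrand is the real integrand at \<open>Re s\<close>, so it is
  integrable, and the truncated integrals \<open>(- 1 / s) * H N s\<close> determine the
  value.\<close>

lemma zeta_eq_frac_integral:
  assumes s: "0 < Re s" "Re s < 1"
  shows "(LINT u:{0<..}|lborel. of_real (frac u) * of_real u powr (-s - 1)) = - zeta s / s"
proof -
  let ?f = "\<lambda>u. complex_of_real (frac u) * of_real u powr (-s - 1)"
  have [measurable]: "(\<lambda>u::real. frac u) \<in> borel_measurable borel"
    unfolding frac_def by measurable
  have "integrable lborel (\<lambda>u. complex_of_real (frac u) * (indicator {0<..} u *\<^sub>R (of_real u powr (-s - 1))))"
    by (rule Bochner_Integration.integrable_bound[OF set_integrable_frac_powr[OF s, unfolded set_integrable_def]])
       (auto simp: indicator_def norm_mult norm_powr_real_powr)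
  then have "set_integrable lborel {0<..} ?f"
    by (simp add: set_integrable_def)
  moreover have "(\<lambda>N. (- 1 / s) * H N s) \<longlonglongrightarrow> (- 1 / s) * zeta s"
    using s by (intro tendsto_intros H_tendsto_zeta) auto
  ultimately have "(LINT u:{0<..}|lborel. ?f u) = (- 1 / s) * zeta s"
    by (rule set_integral_limit[OF _ has_integral_H[OF s]])
  then show ?thesis by simp
qed

text \<open>Euler-Maclaurin with \<open>\<phi> u = - exp (- (x * u)) / x\<close> and antiderivative
  \<open>exp (- (x * u)) / x\<^sup>2\<close>; the sum is geometric.\<close>

lemma frac_integral_exp:
  fixes x :: real
  assumes x: "x > 0"
  shows "(LINT u:{0<..}|lborel. frac u * exp (- (x * u))) = 1 / x\<^sup>2 - 1 / (x * (exp x - 1))"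
proof (rule set_integral_nonneg_limit(2))
  let ?I = "\<lambda>N. (\<Sum>n=1..N. - exp (- (x * real n)) / x) - exp (- (x * real N)) / x\<^sup>2 + exp (- (x * 0)) / x\<^sup>2"
  have "((\<lambda>u. frac u *\<^sub>R exp (- (x * u))) has_integral ?I N) {0..real N}" for N
    using x
    by (intro has_integral_frac)
       (auto intro!: continuous_intros derivative_eq_intros
          simp flip: has_real_derivative_iff_has_vector_derivative simp: power2_eq_square)
  then show "((\<lambda>u. frac u * exp (- (x * u))) has_integral ?I N) {0..real N}" for N
    by simp
  have q: "(\<lambda>n. exp (- x) * exp (- x) ^ n) sums (exp (- x) * (1 / (1 - exp (- x))))"
    using x by (intro sums_mult geometric_sums) auto
  moreover have "(\<Sum>n<N. exp (- x) * exp (- x) ^ n) = (\<Sum>n=1..N. exp (- (x * real n)))" for N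
    by (simp add: sum.atLeast1_atMost_eq exp_of_nat_mult[symmetric] exp_add[symmetric] algebra_simps)
  moreover have "exp (- x) * (1 / (1 - exp (- x))) = 1 / (exp x - 1)"
    using x by (simp add: exp_minus field_simps)
  ultimately have "(\<lambda>N. \<Sum>n=1..N. exp (- (x * real n))) \<longlonglongrightarrow> 1 / (exp x - 1)"
    by (simp add: sums_def)
  moreover have "(\<lambda>N. exp (- (x * real N))) \<longlonglongrightarrow> 0"
    using x by real_asymp
  ultimately have "(\<lambda>N. - (\<Sum>n=1..N. exp (- (x * real n))) / x - exp (- (x * real N)) / x\<^sup>2 + exp (- (x * 0)) / x\<^sup>2)
      \<longlonglongrightarrow> - (1 / (exp x - 1)) / x - 0 / x\<^sup>2 + exp (- (x * 0)) / x\<^sup>2"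
    using x by (intro tendsto_intros) auto
  then show "?I \<longlonglongrightarrow> 1 / x\<^sup>2 - 1 / (x * (exp x - 1))"
    by (simp add: sum_negf sum_divide_distrib mult.commute)
  show "(\<lambda>u. frac u * exp (- (x * u))) \<in> borel_measurable borel"
    unfolding frac_def by measurable
qed auto

text \<open>
  The integrand is left in the form \<open>w u * k (x / u)\<close> so that \<open>mellin_swap\<close> applies; it equals
  \<open>16 * pi\<^sup>2 * frac u * u / (x\<^sup>2 + 4 * pi\<^sup>2 * u\<^sup>2)\<^sup>2\<close>.
\<close>
lemma frac_integral_rational:
  fixes x :: real
  assumes x: "x > 0"
  shows "(LINT u:{0<..}|lborel. 16 * pi\<^sup>2 * (frac u / u ^ 3) * (1 / ((x * (1 / u))\<^sup>2 + 4 * pi\<^sup>2)\<^sup>2)) =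
    1 / x\<^sup>2 - 1 / (x * (exp x - 1))"
proof (rule set_integral_nonneg_limit(2))
  define \<Phi> where "\<Phi> u = - (1 / (pi * x)) * arctan (2 * pi * u / x)" for u
  let ?\<phi> = "\<lambda>u. - 2 / (x\<^sup>2 + 4 * pi\<^sup>2 * u\<^sup>2)"
  let ?I = "\<lambda>N. (\<Sum>n=1..N. ?\<phi> (real n)) - \<Phi> (real N) + \<Phi> 0"
  have pos: "x\<^sup>2 + 4 * pi\<^sup>2 * u\<^sup>2 > 0" for u using x by (intro add_pos_nonneg) auto
  have nz: "x\<^sup>2 + 4 * pi\<^sup>2 * u\<^sup>2 \<noteq> 0" for u using pos[of u] by simp
  have "((\<lambda>u. frac u *\<^sub>R (16 * pi\<^sup>2 * u / (x\<^sup>2 + 4 * pi\<^sup>2 * u\<^sup>2)\<^sup>2)) has_integral ?I N) {0..real N}" for N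
  proof (rule has_integral_frac)
    show "continuous_on {0..} \<Phi>" unfolding \<Phi>_def using x by (intro continuous_intros) auto
    show "continuous_on {0..} (\<lambda>u. u *\<^sub>R ?\<phi> u)" using nz by (intro continuous_intros) auto
    fix u :: real
    have "(?\<phi> has_real_derivative 16 * pi\<^sup>2 * u / (x\<^sup>2 + 4 * pi\<^sup>2 * u\<^sup>2)\<^sup>2) (at u)"
      using nz[of u] by (auto intro!: derivative_eq_intros simp: power2_eq_square)
    then show "(?\<phi> has_vector_derivative 16 * pi\<^sup>2 * u / (x\<^sup>2 + 4 * pi\<^sup>2 * u\<^sup>2)\<^sup>2) (at u)"
      by (simp add: has_real_derivative_iff_has_vector_derivative)
    have "(\<Phi> has_real_derivative - (1 / (pi * x)) * (inverse (1 + (2 * pi * u / x)\<^sup>2) * (2 * pi / x))) (at u)"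
      unfolding \<Phi>_def using x by (auto intro!: derivative_eq_intros)
    moreover have "- (1 / (pi * x)) * (inverse (1 + (2 * pi * u / x)\<^sup>2) * (2 * pi / x)) = ?\<phi> u"
    proof -
      have "1 + (2 * pi * u / x)\<^sup>2 = (x\<^sup>2 + 4 * pi\<^sup>2 * u\<^sup>2) / x\<^sup>2"
        using x by (simp add: field_simps power2_eq_square)
      then show ?thesis using x nz[of u] by (simp add: power2_eq_square)
    qed
    ultimately show "(\<Phi> has_vector_derivative ?\<phi> u) (at u)"
      by (simp add: has_real_derivative_iff_has_vector_derivative)
  qed
  moreover have "16 * pi\<^sup>2 * (frac u / u ^ 3) * (1 / ((x * (1 / u))\<^sup>2 + 4 * pi\<^sup>2)\<^sup>2) =
      frac u *\<^sub>R (16 * pi\<^sup>2 * u / (x\<^sup>2 + 4 * pi\<^sup>2 * u\<^sup>2)\<^sup>2)" for u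
  proof (cases "u = 0")
    case False
    then have "(x * (1 / u))\<^sup>2 + 4 * pi\<^sup>2 = (x\<^sup>2 + 4 * pi\<^sup>2 * u\<^sup>2) / u\<^sup>2"
      by (simp add: field_simps)
    moreover have "a * (b / u ^ 3) * (1 / (D / u\<^sup>2)\<^sup>2) = b * (a * u / D\<^sup>2)" for a b D
      using False by (simp add: power_divide eval_nat_numeral divide_simps)
    ultimately show ?thesis by simp
  qed simp
  ultimately show "((\<lambda>u. 16 * pi\<^sup>2 * (frac u / u ^ 3) * (1 / ((x * (1 / u))\<^sup>2 + 4 * pi\<^sup>2)\<^sup>2))
      has_integral ?I N) {0..real N}" for N
    by simp
  have "(\<lambda>N. - (1 / x) * (\<Sum>n=1..N. 2 * x / (x\<^sup>2 + 4 * pi\<^sup>2 * (real n)\<^sup>2)))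
      \<longlonglongrightarrow> - (1 / x) * (1 / (exp x - 1) - 1 / x + 1 / 2)"
    by (intro tendsto_intros coth_partial_fraction x)
  moreover have "- (1 / x) * (\<Sum>n=1..N. 2 * x / (x\<^sup>2 + 4 * pi\<^sup>2 * (real n)\<^sup>2)) = (\<Sum>n=1..N. ?\<phi> (real n))" for N
    unfolding sum_distrib_left using x by (intro sum.cong) (auto simp: divide_simps)
  moreover have "(\<lambda>N. \<Phi> (real N)) \<longlonglongrightarrow> - (1 / (pi * x)) * (pi / 2)"
    unfolding \<Phi>_def
  proof (intro tendsto_mult tendsto_const)
    have "filterlim (\<lambda>N. 2 * pi * real N / x) at_top sequentially"
      using x by real_asymp
    then show "(\<lambda>N. arctan (2 * pi * real N / x)) \<longlonglongrightarrow> pi / 2"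
      by (rule filterlim_compose[OF tendsto_arctan_at_top])
  qed
  \<comment> \<open>The limit of the arctangent contributes \<open>1 / (2 * x)\<close>, which
    cancels the constant \<open>1 / 2\<close> from the partial fraction expansion.\<close>
  ultimately have "?I \<longlonglongrightarrow> - (1 / x) * (1 / (exp x - 1) - 1 / x + 1 / 2) - (- (1 / (pi * x)) * (pi / 2)) + \<Phi> 0"
    by (intro tendsto_intros) simp_all
  also have "- (1 / x) * (1 / (exp x - 1) - 1 / x + 1 / 2) - (- (1 / (pi * x)) * (pi / 2)) + \<Phi> 0 =
      1 / x\<^sup>2 - 1 / (x * (exp x - 1))"
    using x by (simp add: \<Phi>_def field_simps power2_eq_square)
  finally show "?I \<longlonglongrightarrow> 1 / x\<^sup>2 - 1 / (x * (exp x - 1))" .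
  show "(\<lambda>u. 16 * pi\<^sup>2 * (frac u / u ^ 3) * (1 / ((x * (1 / u))\<^sup>2 + 4 * pi\<^sup>2)\<^sup>2)) \<in> borel_measurable borel"
    unfolding frac_def by measurable
qed auto

section \<open>Reflection of zeros in the critical strip\<close>

text \<open>Euler's integral, transferred from the completed measure to \<open>lborel\<close>, the
  measure used for the Fubini argument.\<close>

lemma Gamma_set_integral:
  assumes "Re s > -1"
  shows "set_integrable lborel {0<..} (\<lambda>x. of_real x powr s * of_real (exp (- x)) :: complex)"
    and "(LINT x:{0<..}|lborel. of_real x powr s * of_real (exp (- x)) :: complex) = Gamma (s + 1)"
proof -
  have eq: "complex_of_real x powr s * of_real (exp (- x)) = of_real x powr (s + 1 - 1) / of_real (exp x)" for x
    by (simp add: exp_minus divide_inverse)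
  have *: "set_integrable lebesgue {0<..} (\<lambda>x. of_real x powr s * of_real (exp (- x)) :: complex)"
    unfolding eq using assms by (intro absolutely_integrable_Gamma_integral') auto
  have "(\<lambda>x. (indicator {0<..} x *\<^sub>R complex_of_real x powr s) * of_real (exp (- x))) \<in> borel_measurable borel"
    by measurable
  then have meas: "(\<lambda>x. indicator {0<..} x *\<^sub>R (complex_of_real x powr s * of_real (exp (- x)))) \<in> borel_measurable lborel"
    by simp
  show int: "set_integrable lborel {0<..} (\<lambda>x. of_real x powr s * of_real (exp (- x)) :: complex)"
    using * unfolding set_integrable_def by (subst (asm) integrable_completion[OF meas])
  have "((\<lambda>x. of_real x powr s * of_real (exp (- x)) :: complex) has_integral Gamma (s + 1)) {0<..}"
    unfolding eq using assms by (intro Gamma_integral_complex') auto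
  then show "(LINT x:{0<..}|lborel. of_real x powr s * of_real (exp (- x)) :: complex) = Gamma (s + 1)"
    by (subst set_borel_integral_eq_integral(2)[OF int]) (rule integral_unique)
qed

text \<open>Supplies the dominating function for the Mellin transform of the rational
  kernel.\<close>

lemma set_integrable_inverse_1_plus_square:
  "set_integrable lborel {0<..} (\<lambda>x::real. 1 / (1 + x\<^sup>2))"
proof (rule set_integral_nonneg_limit(1))
  show "((\<lambda>x::real. 1 / (1 + x\<^sup>2)) has_integral arctan (real N) - arctan 0) {0..real N}" for N
    by (rule fundamental_theorem_of_calculus)
       (auto intro!: derivative_eq_intros simp: inverse_eq_divide
          simp flip: has_real_derivative_iff_has_vector_derivative)
  show "(\<lambda>N. arctan (real N) - arctan 0) \<longlonglongrightarrow> pi / 2 - arctan 0"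
    by (intro tendsto_diff tendsto_const filterlim_compose[OF tendsto_arctan_at_top] filterlim_real_sequentially)
qed auto

text \<open>
  The factor multiplying \<open>zeta (1 - s)\<close> in the functional equation obtained here is a Mellin
  transform whose value is irrelevant; only \<open>Gamma (s + 1) \<noteq> 0\<close> on the other side matters.
\<close>
lemma zeta_reflect_zero:
  assumes s: "0 < Re s" "Re s < 1" and zero: "zeta (1 - s) = 0"
  shows "zeta s = 0"
proof -
  define k where "k x = 1 / (x\<^sup>2 + 4 * pi\<^sup>2)\<^sup>2" for x :: real
  define w where "w u = 16 * pi\<^sup>2 * (frac u / u ^ 3)" for u :: real
  have [measurable]: "(\<lambda>u::real. frac u) \<in> borel_measurable borel"
    unfolding frac_def by measurable
  have [measurable]: "k \<in> borel_measurable borel" unfolding k_def by measurable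
  have [measurable]: "w \<in> borel_measurable borel" unfolding w_def by measurable
  have "(LINT x:{0<..}|lborel. of_real x powr s * of_real (LINT u:{0<..}|lborel. frac u * exp (- (x * u)))) =
      (LINT u:{0<..}|lborel. of_real (frac u) * of_real u powr (-s - 1)) *
      (LINT x:{0<..}|lborel. of_real x powr s * of_real (exp (- x)) :: complex)"
  proof (rule mellin_swap)
    have "set_integrable lborel {0<..} (\<lambda>x. norm (of_real x powr s * of_real (exp (- x)) :: complex))"
      using s by (intro set_integrable_norm Gamma_set_integral) auto
    also have "?this \<longleftrightarrow> set_integrable lborel {0<..} (\<lambda>x. x powr Re s * exp (- x))"
      by (intro set_integrable_cong) (auto simp: norm_mult norm_powr_real_powr)
    finally show "set_integrable lborel {0<..} (\<lambda>x. x powr Re s * exp (- x))" .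
    show "set_integrable lborel {0<..} (\<lambda>u. frac u * u powr (- Re s - 1))"
      by (rule set_integrable_frac_powr[OF s])
  qed auto
  also have "(LINT u:{0<..}|lborel. of_real (frac u) * of_real u powr (-s - 1)) = - zeta s / s"
    by (rule zeta_eq_frac_integral[OF s])
  also have "(LINT x:{0<..}|lborel. of_real x powr s * of_real (exp (- x)) :: complex) = Gamma (s + 1)"
    using s by (intro Gamma_set_integral) auto
  \<comment> \<open>The pivot: for each \<open>x > 0\<close> the exponential and the rational kernel
    have the same inner integral. The second exchange then uses \<open>c u = 1 / u\<close>, which
    turns \<open>s\<close> into \<open>1 - s\<close>.\<close>
  also have "(LINT x:{0<..}|lborel. of_real x powr s * of_real (LINT u:{0<..}|lborel. frac u * exp (- (x * u)))) =
      (LINT x:{0<..}|lborel. of_real x powr s * complex_of_real (LINT u:{0<..}|lborel. w u * k (x * (1 / u))))"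
    by (rule set_lebesgue_integral_cong)
       (simp_all add: frac_integral_exp frac_integral_rational[symmetric] w_def k_def)
  also have "\<dots> = (LINT u:{0<..}|lborel. of_real (w u) * of_real (1 / u) powr (-s - 1)) *
      (LINT x:{0<..}|lborel. of_real x powr s * of_real (k x))"
  proof (rule mellin_swap)
    have "integrable lborel (\<lambda>x. indicator {0<..} x *\<^sub>R (x powr Re s * k x))"
    proof (rule Bochner_Integration.integrable_bound[OF set_integrable_inverse_1_plus_square[unfolded set_integrable_def]])
      \<comment> \<open>Since \<open>0 < Re s < 1\<close>, the power is at most
        \<open>1 + x\<close>; both \<open>1 + x\<close> and \<open>1 + x\<^sup>2\<close> are at most
        \<open>x\<^sup>2 + 4 * pi\<^sup>2\<close>, whose square is the denominator of
        \<open>k\<close>.\<close>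
      have "x powr Re s * k x \<le> 1 / (1 + x\<^sup>2)" if x: "x > 0" for x
      proof -
        have "x powr Re s \<le> 1 + x"
        proof (cases "x \<le> 1")
          case True
          then have "x powr Re s \<le> 1" using x s by (intro powr_le1) auto
          then show ?thesis using x by simp
        next
          case False
          then have "x powr Re s \<le> x powr 1" using s by (intro powr_mono) auto
          then show ?thesis using x by simp
        qed
        moreover have "1 + x \<le> x\<^sup>2 + 4 * pi\<^sup>2" "1 + x\<^sup>2 \<le> x\<^sup>2 + 4 * pi\<^sup>2"
        proof -
          have "2\<^sup>2 \<le> pi\<^sup>2" using pi_ge_two by (intro power_mono) auto
          moreover have "0 \<le> (x - 1)\<^sup>2" by simp
          ultimately show "1 + x \<le> x\<^sup>2 + 4 * pi\<^sup>2" "1 + x\<^sup>2 \<le> x\<^sup>2 + 4 * pi\<^sup>2"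
            using x by (simp_all add: power2_eq_square algebra_simps)
        qed
        ultimately have "x powr Re s * (1 + x\<^sup>2) \<le> (x\<^sup>2 + 4 * pi\<^sup>2) * (x\<^sup>2 + 4 * pi\<^sup>2)"
          by (intro mult_mono) auto
        moreover have "0 < x\<^sup>2 + 4 * pi\<^sup>2" "0 < 1 + x\<^sup>2" using x by (simp_all add: add_pos_pos)
        moreover have "p * (1 / D\<^sup>2) \<le> 1 / q" if "p * q \<le> D * D" "0 < D" "0 < q" for p q D :: real
        proof -
          have "0 < D * D" using that by simp
          then show ?thesis using that by (simp add: power2_eq_square divide_simps)
        qed
        ultimately show ?thesis unfolding k_def by blast
      qed
      then show "AE x in lborel. norm (indicator {0<..} x *\<^sub>R (x powr Re s * k x)) \<le>
          norm (indicator {0<..} x *\<^sub>R (1 / (1 + x\<^sup>2)))"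
        by (auto simp: indicator_def k_def abs_mult)
    qed measurable
    then show "set_integrable lborel {0<..} (\<lambda>x. x powr Re s * k x)" by (simp add: set_integrable_def)
    \<comment> \<open>After the powers of \<open>u\<close> are combined, the weight is a multiple of
      the fractional-part integrand at \<open>1 - Re s\<close>, again in the open unit
      interval.\<close>
    have "set_integrable lborel {0<..} (\<lambda>u. 16 * pi\<^sup>2 * (frac u * u powr (- (1 - Re s) - 1)))"
      using s by (intro set_integrable_mult_right set_integrable_frac_powr) auto
    also have "?this \<longleftrightarrow> set_integrable lborel {0<..} (\<lambda>u. w u * (1 / u) powr (- Re s - 1))"
    proof (intro set_integrable_cong refl)
      fix u :: real assume "u \<in> {0<..}"
      then have u: "u > 0" by simp
      have "(1 / u) powr (- Re s - 1) = u powr (1 + Re s)"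
        using u by (simp add: powr_def ln_div algebra_simps)
      also have "\<dots> = u powr (Re s - 2) * u ^ 3"
      proof -
        have "u powr (1 + Re s) = u powr ((Re s - 2) + 3)" by simp
        then show ?thesis using u by (simp only: powr_add powr_numeral)
      qed
      finally show "16 * pi\<^sup>2 * (frac u * u powr (- (1 - Re s) - 1)) = w u * (1 / u) powr (- Re s - 1)"
        using u by (simp add: w_def)
    qed
    finally show "set_integrable lborel {0<..} (\<lambda>u. w u * (1 / u) powr (- Re s - 1))" .
  qed (auto simp: k_def w_def)
  also have "(LINT u:{0<..}|lborel. of_real (w u) * of_real (1 / u) powr (-s - 1)) =
      (LINT u:{0<..}|lborel. of_real (16 * pi\<^sup>2) * (of_real (frac u) * of_real u powr (- (1 - s) - 1)))"
  proof (intro set_lebesgue_integral_cong allI impI)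
    fix u :: real assume "u \<in> {0<..}"
    then have u: "u > 0" by simp
    \<comment> \<open>Splitting off \<open>u ^ 3\<close> cancels the denominator of
      \<open>w u\<close>; the remaining exponent \<open>s - 2\<close> is
      \<open>- (1 - s) - 1\<close>.\<close>
    have "complex_of_real (1 / u) powr (-s - 1) = of_real u powr (s - 2 + of_nat 3)"
      using u unfolding powr_def by (simp add: Ln_of_real ln_div algebra_simps del: of_real_divide)
    also have "\<dots> = of_real u powr (s - 2) * of_real u ^ 3"
      using u by (simp only: powr_add powr_nat') (simp add: powr_nat)
    finally show "of_real (w u) * of_real (1 / u) powr (-s - 1) =
        of_real (16 * pi\<^sup>2) * (of_real (frac u) * complex_of_real u powr (- (1 - s) - 1))"
      using u by (simp add: w_def)
  qed simp
  also have "\<dots> = of_real (16 * pi\<^sup>2) * (- zeta (1 - s) / (1 - s))"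
    using s by (simp only: set_integral_mult_right, subst zeta_eq_frac_integral) auto
  finally have "- zeta s / s * Gamma (s + 1) = 0" using zero by simp
  moreover have "s + 1 \<notin> \<int>\<^sub>\<le>\<^sub>0" using s by (auto elim!: nonpos_Ints_cases simp: complex_eq_iff)
  then have "Gamma (s + 1) \<noteq> 0" by (simp add: Gamma_eq_zero_iff)
  ultimately show ?thesis using s by auto
qed

section \<open>Tools for passing from zero-free combinations to zeta\<close>

lemma uniform_limit_sum:
  fixes f :: "'i \<Rightarrow> 'n \<Rightarrow> 'x \<Rightarrow> 'a::real_normed_vector"
  assumes "\<And>i. i \<in> I \<Longrightarrow> uniform_limit X (f i) (g i) F"
  shows "uniform_limit X (\<lambda>n x. \<Sum>i\<in>I. f i n x) (\<lambda>x. \<Sum>i\<in>I. g i x) F"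
  using assms by (induction I rule: infinite_finite_induct) (auto intro!: uniform_limit_intros)

text \<open>The identity theorem would spread the zeros to 2, where the Dirichlet series has
  positive terms. This rules out the degenerate case of Hurwitz's theorem.\<close>

lemma not_zeta_zero_on_ball:
  assumes r: "r > 0" and ball: "ball c r \<subseteq> {s. Re s > 0} - {1}" and zero: "\<And>s. s \<in> ball c r \<Longrightarrow> zeta s = 0"
  shows False
proof -
  have "zeta 2 = 0"
  proof (rule analytic_continuation_open[where s = "ball c r" and s' = "{s. Re s > 0} - {1}" and f = zeta and g = "\<lambda>_. 0"])
    show "open ({s. Re s > 0} - {1::complex})"
      by (intro open_delete open_halfspace_Re_gt)
    show "connected ({s. Re s > 0} - {1::complex})"
      by (intro connected_open_delete open_halfspace_Re_gt convex_connected convex_halfspace_Re_gt) auto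
    show "zeta holomorphic_on {s. Re s > 0} - {1}" by (rule holomorphic_on_zeta)
    show "ball c r \<noteq> {}" using r by simp
  qed (use ball zero in auto)
  moreover have "(\<lambda>n. of_nat (Suc n) powr (-2)) sums zeta 2"
    using continues_zeta_lim_H zeta_eq_lim_H[of 2] by (simp add: continues_zeta_def)
  ultimately have "(\<lambda>n. Re (of_nat (Suc n) powr (-2))) sums 0"
    using sums_Re by fastforce
  moreover have "of_nat (Suc n) powr (-2) = complex_of_real (real (Suc n) powr (-2))" for n
    using powr_of_real[of "real (Suc n)" "-2"] by simp
  ultimately have sums: "(\<lambda>n. real (Suc n) powr (-2)) sums 0"
    by (simp only: Re_complex_of_real)
  have "0 < (\<Sum>n. real (Suc n) powr (-2))"
    by (rule suminf_pos[OF sums_summable[OF sums]]) simp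
  with sums show False by (simp add: sums_iff)
qed

lemma uniform_limit_H_combination:
  fixes d :: nat and \<alpha> :: "nat \<Rightarrow> complex" and L :: "nat \<Rightarrow> nat"
  assumes K: "compact K" "K \<subseteq> {s. Re s > 0} - {1}" and f: "uniform_limit K f (\<lambda>_. 0) sequentially"
    and d: "d \<ge> 1"
  shows "uniform_limit K (\<lambda>N s. f N s + \<alpha> 1 * H N s + (\<Sum>i=2..d. \<alpha> i * H (N + L (i - 1)) s)
    + (1 - (\<Sum>i=1..d. \<alpha> i)) * H (N + L d) s) zeta sequentially"
proof -
  have H: "uniform_limit K (\<lambda>N s. c * H (N + l) s) (\<lambda>s. c * zeta s) sequentially" for c l
  proof (rule bounded_linear.uniform_limit[OF bounded_linear_mult_right])
    show "uniform_limit K (\<lambda>N. H (N + l)) zeta sequentially"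
      by (rule filterlim_compose[OF uniform_limit_H[OF K] filterlim_add_const_nat_at_top])
  qed
  have "uniform_limit K (\<lambda>N s. f N s + \<alpha> 1 * H N s + (\<Sum>i=2..d. \<alpha> i * H (N + L (i - 1)) s)
      + (1 - (\<Sum>i=1..d. \<alpha> i)) * H (N + L d) s)
    (\<lambda>s. 0 + \<alpha> 1 * zeta s + (\<Sum>i=2..d. \<alpha> i * zeta s) + (1 - (\<Sum>i=1..d. \<alpha> i)) * zeta s) sequentially"
    by (intro uniform_limit_add f uniform_limit_sum H H[where l = 0, simplified])
  moreover have "0 + \<alpha> 1 * z + (\<Sum>i=2..d. \<alpha> i * z) + (1 - (\<Sum>i=1..d. \<alpha> i)) * z = z" for z
  proof -
    \<comment> \<open>Here \<open>d \<ge> 1\<close> puts \<open>\<alpha> 1\<close> into the sum over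
      \<open>1..d\<close>, so that the weights total 1.\<close>
    have "(\<Sum>i=1..d. \<alpha> i) = \<alpha> 1 + (\<Sum>i=2..d. \<alpha> i)"
      using d by (simp add: sum.atLeast_Suc_atMost numeral_2_eq_2)
    then show ?thesis by (simp add: algebra_simps sum_distrib_left)
  qed
  ultimately show ?thesis by simp
qed

text \<open>Continuity on a compact set bounds the norms, so that \<open>SUP\<close> is a genuine
  upper bound for each value.\<close>

lemma uniform_limit_SUP_norm:
  fixes f :: "nat \<Rightarrow> complex \<Rightarrow> complex"
  assumes K: "compact K" and cont: "\<And>N. continuous_on K (f N)"
    and SUP: "(\<lambda>N. SUP s\<in>K. norm (f N s)) \<longlonglongrightarrow> 0"
  shows "uniform_limit K f (\<lambda>_. 0) sequentially"
proof (rule uniform_limitI)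
  fix e :: real assume "e > 0"
  with SUP have "\<forall>\<^sub>F N in sequentially. (SUP s\<in>K. norm (f N s)) < e"
    by (rule order_tendstoD)
  then show "\<forall>\<^sub>F N in sequentially. \<forall>s\<in>K. dist (f N s) 0 < e"
  proof eventually_elim
    case (elim N)
    have "compact ((\<lambda>s. norm (f N s)) ` K)"
      using K cont by (intro compact_continuous_image continuous_intros)
    then have "bdd_above ((\<lambda>s. norm (f N s)) ` K)"
      by (intro bounded_imp_bdd_above compact_imp_bounded)
    then have "norm (f N s) \<le> (SUP s\<in>K. norm (f N s))" if "s \<in> K" for s
      using that by (rule cSUP_upper[rotated])
    then show ?case using elim by fastforce
  qed
qed

section \<open>The Riemann Hypothesis and zero-free combinations of \<open>H N\<close>\<close>

text \<open>Zeros in the strip come in pairs \<open>s\<close>, \<open>1 - s\<close>, and off the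
  critical line one of the two lies to its right.\<close>

lemma riemann_hypothesis_iff:
  "riemann_hypothesis \<longleftrightarrow> (\<forall>s. 1 / 2 < Re s \<and> Re s < 1 \<longrightarrow> zeta s \<noteq> 0)"
proof
  assume *: "\<forall>s. 1 / 2 < Re s \<and> Re s < 1 \<longrightarrow> zeta s \<noteq> 0"
  show riemann_hypothesis
    unfolding riemann_hypothesis_def
  proof (intro allI impI)
    fix s assume s: "0 < Re s \<and> Re s < 1 \<and> zeta s = 0"
    then have "zeta (1 - s) = 0" using zeta_reflect_zero[of "1 - s"] by simp
    then have "\<not> (1 / 2 < Re s)" "\<not> (1 / 2 < Re (1 - s))" using * s by auto
    then show "Re s = 1 / 2" by simp
  qed
next
  assume rh: riemann_hypothesis
  show "\<forall>s. 1 / 2 < Re s \<and> Re s < 1 \<longrightarrow> zeta s \<noteq> 0"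
  proof (intro allI impI notI)
    fix s assume "1 / 2 < Re s \<and> Re s < 1" "zeta s = 0"
    moreover from this have "Re s = 1 / 2"
      by (intro rh[unfolded riemann_hypothesis_def, rule_format]) auto
    ultimately show False by simp
  qed
qed

theorem theorem3p3:
  "riemann_hypothesis \<longleftrightarrow>
     (\<forall>(c::complex) (r::real). r > 0 \<and> cball c r \<subseteq> {s. 1 / 2 < Re s \<and> Re s < 1} \<longrightarrow>
       (\<exists>(f :: nat \<Rightarrow> complex \<Rightarrow> complex) (d::nat) (\<alpha> :: nat \<Rightarrow> complex) (L :: nat \<Rightarrow> nat) (N\<^sub>0::nat).
          (\<forall>N. f N analytic_on cball c r) \<and>
          (\<lambda>N. SUP s\<in>cball c r. norm (f N s)) \<longlonglongrightarrow> 0 \<and>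
          d \<ge> 1 \<and> (\<forall>i\<in>{1..d}. L i > 0) \<and> N\<^sub>0 > 0 \<and>
          infinite {N. N > N\<^sub>0 \<and>
            (\<forall>s\<in>cball c r.
               f N s + \<alpha> 1 * H N s + (\<Sum>i=2..d. \<alpha> i * H (N + L (i - 1)) s)
                 + (1 - (\<Sum>i=1..d. \<alpha> i)) * H (N + L d) s \<noteq> 0)}))"
  unfolding riemann_hypothesis_iff
proof (intro iffI allI impI)
  fix c :: complex and r :: real
  assume nz: "\<forall>s. 1 / 2 < Re s \<and> Re s < 1 \<longrightarrow> zeta s \<noteq> 0"
    and r: "r > 0 \<and> cball c r \<subseteq> {s. 1 / 2 < Re s \<and> Re s < 1}"
  let ?K = "cball c r"
  have K: "?K \<subseteq> {s. Re s > 0} - {1}" using r by fastforce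
  have "continuous_on ?K zeta"
    by (rule holomorphic_on_imp_continuous_on[OF holomorphic_on_subset[OF holomorphic_on_zeta K]])
  then have "continuous_on ?K (\<lambda>s. norm (zeta s))" by (rule continuous_on_norm)
  moreover have "?K \<noteq> {}" using r by auto
  \<comment> \<open>The minimum of \<open>norm (zeta s)\<close> on the disc is positive, and any
    function uniformly closer to zeta than this minimum has no zero there.\<close>
  ultimately obtain s0 where s0: "s0 \<in> ?K" "\<And>s. s \<in> ?K \<Longrightarrow> norm (zeta s0) \<le> norm (zeta s)"
    using continuous_attains_inf[OF compact_cball, of c r "\<lambda>s. norm (zeta s)"] by blast
  have "norm (zeta s0) > 0" using nz r s0(1) by auto
  with uniform_limit_H[OF compact_cball K]
  have "\<forall>\<^sub>F N in sequentially. \<forall>s\<in>?K. dist (H N s) (zeta s) < norm (zeta s0)"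
    by (rule uniform_limitD)
  then obtain M where M: "\<And>N s. N \<ge> M \<Longrightarrow> s \<in> ?K \<Longrightarrow> dist (H N s) (zeta s) < norm (zeta s0)"
    unfolding eventually_sequentially by blast
  have "H N s \<noteq> 0" if "N \<ge> M" "s \<in> ?K" for N s
    using M[OF that] s0(2)[OF that(2)] by (auto simp: dist_norm)
  then have "{N. N > max 1 M} \<subseteq> {N. N > 1 \<and> (\<forall>s\<in>?K. H N s \<noteq> 0)}" by auto
  moreover have "infinite {N. N > max 1 M}"
    using infinite_Ioi[of "max 1 M"] by (simp add: greaterThan_def)
  ultimately have inf: "infinite {N. N > 1 \<and> (\<forall>s\<in>?K. H N s \<noteq> 0)}"
    by (rule infinite_super)
  \<comment> \<open>With \<open>f = 0\<close>, \<open>d = 1\<close> and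
    \<open>\<alpha> 1 = 1\<close> the last weight is 0 and the middle sum is empty, so the
    combination is \<open>H N\<close> itself.\<close>
  show "\<exists>(f :: nat \<Rightarrow> complex \<Rightarrow> complex) (d::nat) (\<alpha> :: nat \<Rightarrow> complex) (L :: nat \<Rightarrow> nat) (N\<^sub>0::nat).
      (\<forall>N. f N analytic_on ?K) \<and> (\<lambda>N. SUP s\<in>?K. norm (f N s)) \<longlonglongrightarrow> 0 \<and>
      d \<ge> 1 \<and> (\<forall>i\<in>{1..d}. L i > 0) \<and> N\<^sub>0 > 0 \<and>
      infinite {N. N > N\<^sub>0 \<and> (\<forall>s\<in>?K. f N s + \<alpha> 1 * H N s + (\<Sum>i=2..d. \<alpha> i * H (N + L (i - 1)) s)
        + (1 - (\<Sum>i=1..d. \<alpha> i)) * H (N + L d) s \<noteq> 0)}"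
    by (rule exI[of _ "\<lambda>_ _. 0"], rule exI[of _ 1], rule exI[of _ "\<lambda>_. 1"], rule exI[of _ "\<lambda>_. 1"], rule exI[of _ 1])
       (use inf \<open>?K \<noteq> {}\<close> in simp)
next
  fix s :: complex
  assume ex: "\<forall>(c::complex) (r::real). r > 0 \<and> cball c r \<subseteq> {s. 1 / 2 < Re s \<and> Re s < 1} \<longrightarrow>
       (\<exists>(f :: nat \<Rightarrow> complex \<Rightarrow> complex) (d::nat) (\<alpha> :: nat \<Rightarrow> complex) (L :: nat \<Rightarrow> nat) (N\<^sub>0::nat).
          (\<forall>N. f N analytic_on cball c r) \<and>
          (\<lambda>N. SUP s\<in>cball c r. norm (f N s)) \<longlonglongrightarrow> 0 \<and>
          d \<ge> 1 \<and> (\<forall>i\<in>{1..d}. L i > 0) \<and> N\<^sub>0 > 0 \<and>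
          infinite {N. N > N\<^sub>0 \<and>
            (\<forall>s\<in>cball c r.
               f N s + \<alpha> 1 * H N s + (\<Sum>i=2..d. \<alpha> i * H (N + L (i - 1)) s)
                 + (1 - (\<Sum>i=1..d. \<alpha> i)) * H (N + L d) s \<noteq> 0)})"
    and s: "1 / 2 < Re s \<and> Re s < 1"
  have "open {s. 1 / 2 < Re s \<and> Re s < 1}"
    by (intro open_Collect_conj open_halfspace_Re_gt open_halfspace_Re_lt)
  with s obtain r where r: "r > 0" "cball s r \<subseteq> {s. 1 / 2 < Re s \<and> Re s < 1}"
    by (metis (mono_tags, lifting) mem_Collect_eq open_contains_cball)
  let ?K = "cball s r"
  have K: "?K \<subseteq> {s. Re s > 0} - {1}" using r by fastforce
  from ex[rule_format, OF conjI[OF r]] obtain f :: "nat \<Rightarrow> complex \<Rightarrow> complex" and d :: nat and \<alpha> :: "nat \<Rightarrow> complex"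
      and L :: "nat \<Rightarrow> nat" and N\<^sub>0 :: nat where
    f: "\<forall>N. f N analytic_on ?K" and SUP: "(\<lambda>N. SUP s\<in>?K. norm (f N s)) \<longlonglongrightarrow> 0" and d: "d \<ge> 1" and
    inf: "infinite {N. N > N\<^sub>0 \<and> (\<forall>s\<in>?K. f N s + \<alpha> 1 * H N s + (\<Sum>i=2..d. \<alpha> i * H (N + L (i - 1)) s)
        + (1 - (\<Sum>i=1..d. \<alpha> i)) * H (N + L d) s \<noteq> 0)}" 
    by (elim exE conjE) (rule that)
  define G where "G N s = f N s + \<alpha> 1 * H N s + (\<Sum>i=2..d. \<alpha> i * H (N + L (i - 1)) s)
        + (1 - (\<Sum>i=1..d. \<alpha> i)) * H (N + L d) s" for N s
  define A where "A = {N. N > N\<^sub>0 \<and> (\<forall>z\<in>?K. G N z \<noteq> 0)}"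
  have inf_A: "infinite A" using inf by (simp only: A_def G_def not_False_eq_True)
  have f_hol: "f N holomorphic_on ?K" for N
    by (rule analytic_imp_holomorphic) (use f in simp)
  have "uniform_limit ?K f (\<lambda>_. 0) sequentially"
  proof (rule uniform_limit_SUP_norm)
    show "continuous_on ?K (f N)" for N
      by (rule holomorphic_on_imp_continuous_on[OF f_hol])
  qed (rule compact_cball SUP)+
  from uniform_limit_H_combination[OF compact_cball K this d, where \<alpha> = \<alpha> and L = L]
  have "uniform_limit ?K G zeta sequentially"
    unfolding G_def .
  \<comment> \<open>Only infinitely many \<open>N\<close> are zero-free, while Hurwitz's theorem
    needs every term to be so; enumerating \<open>A\<close> passes to a subsequence with the same
    limit.\<close>
  then have lim: "uniform_limit ?K (\<lambda>n. G (enumerate A n)) zeta sequentially"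
    by (rule filterlim_compose[OF _ filterlim_subseq]) (intro strict_monoI enumerate_mono inf_A)
  have ball: "ball s r \<subseteq> {s. Re s > 0} - {1}" "1 \<notin> ball s r"
    using K ball_subset_cball by blast+
  show "zeta s \<noteq> 0"
  proof
    assume zero: "zeta s = 0"
    have "zeta s \<noteq> 0"
    proof (rule Hurwitz_no_zeros[of "ball s r" "\<lambda>n. G (enumerate A n)" zeta])
      show "G (enumerate A n) holomorphic_on ball s r" for n
        unfolding G_def[abs_def]
        by (intro holomorphic_intros holomorphic_on_H ball(2) holomorphic_on_subset[OF f_hol] ball_subset_cball)
      show "zeta holomorphic_on ball s r"
        by (rule holomorphic_on_subset[OF holomorphic_on_zeta ball(1)])
      show "uniform_limit K (\<lambda>n. G (enumerate A n)) zeta sequentially" if "K \<subseteq> ball s r" for K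
        using that ball_subset_cball by (intro uniform_limit_on_subset[OF lim]) blast
      \<comment> \<open>The assumed zero at the centre turns constancy into vanishing on the whole
        ball.\<close>
      show "\<not> zeta constant_on ball s r"
      proof
        assume "zeta constant_on ball s r"
        then have "zeta z = 0" if "z \<in> ball s r" for z
          using zero r(1) that unfolding constant_on_def by (metis centre_in_ball)
        then show False by (rule not_zeta_zero_on_ball[OF r(1) ball(1)])
      qed
      show "G (enumerate A n) z \<noteq> 0" if "z \<in> ball s r" for n z
        using enumerate_in_set[OF inf_A, of n] that ball_subset_cball[of s r] unfolding A_def by blast
    qed (use r in auto)
    with zero show False by contradiction
  qed
qed

end
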